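(* Let $a>0$. Then $$\sum_{n=1}^\infty\zeta^n\operatorname{Tr}\bigl(H_a^n-H_1^n\bigr)=\frac{2(a^2-1)}{\sqrt{1-\zeta^2}}\;\frac{\bigl(1-\sqrt{1-\zeta^2}\bigr)^2}{\zeta^2+(1-a^2)\bigl(1-\sqrt{1-\zeta^2}\bigr)^2},$$ where the series on the left-hand side converges for $|\zeta|<1$ if $a\le\sqrt2$ and for $|\zeta|<2a^{-2}\sqrt{a^2-1}$ if $a>\sqrt2$. In particular, $\operatorname{Tr}(H_a^n-H_1^n)=0$ if $n$ is odd.
   Context: $\mathbb{Z}_+=\{0,1,2,\dots\}$ and $(e_n)_{n\ge0}$ is the canonical orthonormal basis of $\ell^2(\mathbb{Z}_+)$. For $a>0$, $H_a$ is the bounded self-adjoint operator on $\ell^2(\mathbb{Z}_+)$ given by $$H_ae_0=\tfrac a2e_1,\qquad H_ae_1=\tfrac12(ae_0+e_2),\qquad H_ae_n=\tfrac12(e_{n-1}+e_{n+1})\ \ (n\ge2).$$ The difference $H_a^n-H_1^n$ has finite rank, and $\operatorname{Tr}$ is the trace. The function $\sqrt{1-\zeta^2}$ is the analytic branch in the unit disc equal to $1$ at $\zeta=0$; at $\zeta=0$ the right-hand side is understood by continuity. *)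

theory Defs
  imports "HOL-Analysis.Analysis"
begin

section \<open>The Hilbert space of square-summable complex sequences\<close>

typedef ell2 = "{x :: nat \<Rightarrow> complex. summable (\<lambda>n. (cmod (x n))\<^sup>2)}"
  morphisms coord Abs_ell2
  by (rule exI[of _ "\<lambda>_. 0"]) simp

setup_lifting type_definition_ell2

lemma summable_coord: "summable (\<lambda>n. (cmod (coord x n))\<^sup>2)"
  using coord[of x] by simp

lemma ell2_eqI: "(\<And>n. coord x n = coord y n) \<Longrightarrow> x = y"
  using coord_inject by blast

lemma square_summable_add:
  fixes x y :: "nat \<Rightarrow> complex"
  assumes "summable (\<lambda>n. (cmod (x n))\<^sup>2)" and "summable (\<lambda>n. (cmod (y n))\<^sup>2)"
  shows "summable (\<lambda>n. (cmod (x n + y n))\<^sup>2)"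
proof (rule summable_comparison_test')
  show "summable (\<lambda>n. 2 * (cmod (x n))\<^sup>2 + 2 * (cmod (y n))\<^sup>2)"
    using assms by (intro summable_add summable_mult)
  fix n :: nat
  have "(cmod (x n + y n))\<^sup>2 \<le> (cmod (x n) + cmod (y n))\<^sup>2"
    by (intro power_mono norm_triangle_ineq) auto
  also have "\<dots> \<le> 2 * (cmod (x n))\<^sup>2 + 2 * (cmod (y n))\<^sup>2"
    using sum_squares_bound[of "cmod (x n)" "cmod (y n)"] by (simp add: power2_sum)
  finally show "norm ((cmod (x n + y n))\<^sup>2) \<le> 2 * (cmod (x n))\<^sup>2 + 2 * (cmod (y n))\<^sup>2"
    by simp
qed

lemma square_summable_scale:
  fixes x :: "nat \<Rightarrow> complex"
  assumes "summable (\<lambda>n. (cmod (x n))\<^sup>2)"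
  shows "summable (\<lambda>n. (cmod (c * x n))\<^sup>2)"
  using summable_mult[OF assms, of "(cmod c)\<^sup>2"] by (simp add: norm_mult power_mult_distrib)

lemma summable_coord_prod: "summable (\<lambda>n. coord x n * cnj (coord y n))"
proof (rule summable_norm_cancel, rule summable_comparison_test')
  show "summable (\<lambda>n. (cmod (coord x n))\<^sup>2 + (cmod (coord y n))\<^sup>2)"
    by (intro summable_add summable_coord)
  show "norm (norm (coord x n * cnj (coord y n))) \<le> (cmod (coord x n))\<^sup>2 + (cmod (coord y n))\<^sup>2" for n
  proof -
    have "0 \<le> cmod (coord x n) * cmod (coord y n)" by simp
    then show ?thesis
      using sum_squares_bound[of "cmod (coord x n)" "cmod (coord y n)"]
      by (simp only: norm_mult complex_mod_cnj real_norm_def abs_norm_cancel mult.assoc)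
  qed
qed

instantiation ell2 :: real_vector
begin

lift_definition zero_ell2 :: ell2 is "\<lambda>_. 0" by simp

lift_definition plus_ell2 :: "ell2 \<Rightarrow> ell2 \<Rightarrow> ell2" is "\<lambda>x y n. x n + y n"
  by (rule square_summable_add)

lift_definition uminus_ell2 :: "ell2 \<Rightarrow> ell2" is "\<lambda>x n. - x n" by simp

lift_definition minus_ell2 :: "ell2 \<Rightarrow> ell2 \<Rightarrow> ell2" is "\<lambda>x y n. x n - y n"
  subgoal for x y using square_summable_add[of x "\<lambda>n. - y n"] by simp
  done

lift_definition scaleR_ell2 :: "real \<Rightarrow> ell2 \<Rightarrow> ell2" is "\<lambda>r x n. complex_of_real r * x n"
  by (rule square_summable_scale)

instance
  by standard (transfer; auto simp: algebra_simps)+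

end

lift_definition cscale :: "complex \<Rightarrow> ell2 \<Rightarrow> ell2" is "\<lambda>c x n. c * x n"
  by (rule square_summable_scale)

lemmas coord_simps [simp] =
  zero_ell2.rep_eq plus_ell2.rep_eq uminus_ell2.rep_eq minus_ell2.rep_eq
  scaleR_ell2.rep_eq cscale.rep_eq

global_interpretation ell2: vector_space cscale
  defines cspan = ell2.span
  by standard (transfer; auto simp: algebra_simps)+

(* Linear in the first argument, conjugate-linear in the second. *)
definition cinner :: "ell2 \<Rightarrow> ell2 \<Rightarrow> complex" where
  "cinner x y = (\<Sum>n. coord x n * cnj (coord y n))"

lemma cinner_add_left: "cinner (x + y) z = cinner x z + cinner y z"
  by (simp add: cinner_def distrib_right suminf_add summable_coord_prod)

lemma cinner_cscale_left: "cinner (cscale c x) y = c * cinner x y"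
  by (simp add: cinner_def mult.assoc suminf_mult summable_coord_prod)

lemma cinner_commute: "cinner y x = cnj (cinner x y)"
proof -
  have "(\<lambda>n. cnj (coord x n * cnj (coord y n))) sums cnj (cinner x y)"
    unfolding cinner_def sums_cnj by (rule summable_sums[OF summable_coord_prod])
  then show ?thesis
    by (simp add: sums_iff cinner_def mult.commute)
qed

lemma cinner_self: "cinner x x = complex_of_real (\<Sum>n. (cmod (coord x n))\<^sup>2)"
  by (simp add: cinner_def suminf_of_real summable_coord flip: complex_norm_square)

instantiation ell2 :: real_inner
begin

definition inner_ell2 :: "ell2 \<Rightarrow> ell2 \<Rightarrow> real" where "inner_ell2 x y = Re (cinner x y)"
definition norm_ell2 :: "ell2 \<Rightarrow> real" where "norm_ell2 x = sqrt (inner x x)"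
definition dist_ell2 :: "ell2 \<Rightarrow> ell2 \<Rightarrow> real" where "dist_ell2 x y = norm (x - y)"
definition sgn_ell2 :: "ell2 \<Rightarrow> ell2" where "sgn_ell2 x = x /\<^sub>R norm x"
definition uniformity_ell2 :: "(ell2 \<times> ell2) filter" where
  "uniformity_ell2 = (INF e\<in>{0<..}. principal {(x, y). dist x y < e})"
definition open_ell2 :: "ell2 set \<Rightarrow> bool" where
  "open_ell2 U \<longleftrightarrow> (\<forall>x\<in>U. \<forall>\<^sub>F (x', y) in uniformity. x' = x \<longrightarrow> y \<in> U)"

instance
proof
  fix x y z :: ell2 and r :: real
  show "inner x y = inner y x"
    unfolding inner_ell2_def by (subst cinner_commute) simp
  show "inner (x + y) z = inner x z + inner y z"
    by (simp add: inner_ell2_def cinner_add_left)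
  have "r *\<^sub>R x = cscale (complex_of_real r) x"
    by (rule ell2_eqI) simp
  then show "inner (r *\<^sub>R x) y = r * inner x y"
    by (simp add: inner_ell2_def cinner_cscale_left)
  show "0 \<le> inner x x"
    by (simp add: inner_ell2_def cinner_self suminf_nonneg summable_coord)
  show "inner x x = 0 \<longleftrightarrow> x = 0"
  proof
    assume "inner x x = 0"
    then have "\<forall>n. (cmod (coord x n))\<^sup>2 = 0"
      by (subst suminf_eq_zero_iff[symmetric]) (auto simp: inner_ell2_def cinner_self summable_coord)
    then show "x = 0" by (intro ell2_eqI) simp
  qed (simp add: inner_ell2_def cinner_self)
qed (auto simp: norm_ell2_def dist_ell2_def sgn_ell2_def uniformity_ell2_def open_ell2_def)

end

lemma norm_ell2_eq: "norm x = sqrt (\<Sum>n. (cmod (coord x n))\<^sup>2)"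
  by (simp add: norm_ell2_def inner_ell2_def cinner_self)

lift_definition basis_vec :: "nat \<Rightarrow> ell2" is "\<lambda>n k. if k = n then 1 else 0"
  by (rule summable_finite[of "{n}" for n]) auto

lemma coord_basis_vec [simp]: "coord (basis_vec n) k = (if k = n then 1 else 0)"
  by transfer simp

lemma cinner_basis_vec: "cinner x (basis_vec n) = coord x n"
proof -
  have "cinner x (basis_vec n) = (\<Sum>k\<in>{n}. coord x k * cnj (coord (basis_vec n) k))"
    unfolding cinner_def by (rule suminf_finite) auto
  then show ?thesis by simp
qed


section \<open>Finite-rank operators and the trace\<close>

definition finite_rank :: "(ell2 \<Rightarrow> ell2) \<Rightarrow> bool" where
  "finite_rank T \<longleftrightarrow> Vector_Spaces.linear cscale cscale T \<and> (\<exists>B. finite B \<and> range T \<subseteq> cspan B)"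

(* Diagonal sum in the canonical basis.  For finite rank the series converges absolutely and
   any orthonormal basis gives the same value. *)
definition ell2_trace :: "(ell2 \<Rightarrow> ell2) \<Rightarrow> complex" where
  "ell2_trace T = (\<Sum>n. cinner (T (basis_vec n)) (basis_vec n))"


section \<open>The operators\<close>

lemma square_summable_jacobi:
  fixes x :: "nat \<Rightarrow> complex"
  assumes x: "summable (\<lambda>n. (cmod (x n))\<^sup>2)"
  shows "summable (\<lambda>n. (cmod (if n = 0 then complex_of_real (a / 2) * x 1
      else if n = 1 then (complex_of_real a * x 0 + x 2) / 2
      else (x (n - 1) + x (n + 1)) / 2))\<^sup>2)"
proof -
  have "summable (\<lambda>n. (cmod (x n + x (n + 2)))\<^sup>2)"
    using x summable_iff_shift[of "\<lambda>n. (cmod (x n))\<^sup>2" 2] by (intro square_summable_add) auto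
  then have "summable (\<lambda>n. (cmod ((1 / 2) * (x n + x (n + 2))))\<^sup>2)"
    by (rule square_summable_scale)
  then have "summable (\<lambda>n. (cmod ((1 / 2) * (x (n + 1) + x (n + 1 + 2))))\<^sup>2)"
    by (rule summable_ignore_initial_segment)
  then show ?thesis
    by (subst summable_iff_shift[of _ 2, symmetric]) (simp add: numeral_3_eq_3)
qed

(* The coordinates of H a x, determined by the action on the basis (lemma H_basis_vec below)
   together with linearity and boundedness. *)
lift_definition H :: "real \<Rightarrow> ell2 \<Rightarrow> ell2" is
  "\<lambda>a x n. if n = 0 then complex_of_real (a / 2) * x 1
      else if n = 1 then (complex_of_real a * x 0 + x 2) / 2
      else (x (n - 1) + x (n + 1)) / 2"
  by (rule square_summable_jacobi)

lemma H_basis_vec: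
  "H a (basis_vec 0) = (a / 2) *\<^sub>R basis_vec 1"
  "H a (basis_vec 1) = (1 / 2) *\<^sub>R (a *\<^sub>R basis_vec 0 + basis_vec 2)"
  "n \<ge> 2 \<Longrightarrow> H a (basis_vec n) = (1 / 2) *\<^sub>R (basis_vec (n - 1) + basis_vec (n + 1))"
  by (rule ell2_eqI; auto simp: H.rep_eq)+

lemma linear_H: "Vector_Spaces.linear cscale cscale (H a)"
  by (simp add: Vector_Spaces.linear_iff ell2.vector_space_axioms)
    (auto intro!: ell2_eqI simp: H.rep_eq algebra_simps add_divide_distrib)

lemma H_selfadjoint: "cinner (H a x) y = cinner x (H a y)"
proof -
  let ?d = "\<lambda>n. coord (H a x) n * cnj (coord y n) - coord x n * cnj (coord (H a y) n)"
  let ?r = "\<lambda>N. (coord x (N + 1) * cnj (coord y N) - coord x N * cnj (coord y (N + 1))) / 2"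
  have partial: "(\<Sum>n<N + 2. ?d n) = ?r (N + 1)" for N
  proof (induction N)
    case 0
    show ?case
      by (simp add: H.rep_eq numeral_2_eq_2 algebra_simps add_divide_distrib diff_divide_distrib)
  next
    case (Suc N)
    then show ?case
      by (simp add: H.rep_eq numeral_2_eq_2 algebra_simps add_divide_distrib diff_divide_distrib)
  qed
  have lim0: "(\<lambda>n. coord u n) \<longlonglongrightarrow> 0" for u
    using tendsto_real_sqrt[OF summable_LIMSEQ_zero[OF summable_coord[of u]]]
    by (simp add: tendsto_norm_zero_iff)
  have "?r \<longlonglongrightarrow> (0 * cnj 0 - 0 * cnj 0) / 2"
    by (intro tendsto_intros lim0 LIMSEQ_ignore_initial_segment) simp
  then have "(\<lambda>N. ?r (N + 1)) \<longlonglongrightarrow> 0"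
    using LIMSEQ_ignore_initial_segment[of ?r 0 1] by simp
  then have "(\<lambda>N. \<Sum>n<N + 2. ?d n) \<longlonglongrightarrow> 0"
    by (simp only: partial)
  then have "?d sums 0"
    unfolding sums_def by (rule LIMSEQ_offset)
  moreover have "?d sums (cinner (H a x) y - cinner x (H a y))"
    unfolding cinner_def by (intro sums_diff summable_sums summable_coord_prod)
  ultimately show ?thesis
    using sums_unique2 by fastforce
qed

lemma bounded_linear_H: "bounded_linear (H a)"
proof (rule bounded_linear_intro[where K = "sqrt (2 * (a\<^sup>2 + 1))"])
  show "H a (x + y) = H a x + H a y" for x y
    by (rule ell2_eqI) (simp add: H.rep_eq algebra_simps add_divide_distrib)
  show "H a (r *\<^sub>R x) = r *\<^sub>R H a x" for r x
    by (rule ell2_eqI) (simp add: H.rep_eq algebra_simps add_divide_distrib)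
  show "norm (H a x) \<le> norm x * sqrt (2 * (a\<^sup>2 + 1))" for x
  proof -
    let ?s = "\<lambda>n. (cmod (coord x n))\<^sup>2"
    let ?p = "\<lambda>n. if n = 0 then 0 else ?s (n - 1)"
    have "?s sums suminf ?s"
      by (rule summable_sums[OF summable_coord])
    then have p: "?p sums suminf ?s"
      by (subst sums_Suc_iff[of ?p, simplified, symmetric]) simp
    have q: "summable (\<lambda>n. ?s (Suc n))"
      by (subst summable_Suc_iff) (rule summable_coord)
    have q_le: "(\<Sum>n. ?s (Suc n)) \<le> suminf ?s"
      using suminf_split_head[OF summable_coord[of x]] by simp
    have sum2: "(cmod (u + v))\<^sup>2 \<le> 2 * (cmod u)\<^sup>2 + 2 * (cmod v)\<^sup>2" for u v
    proof -
      have "(cmod (u + v))\<^sup>2 \<le> (cmod u + cmod v)\<^sup>2"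
        by (intro power_mono norm_triangle_ineq) auto
      also have "\<dots> \<le> 2 * (cmod u)\<^sup>2 + 2 * (cmod v)\<^sup>2"
        using sum_squares_bound[of "cmod u" "cmod v"] by (simp add: power2_sum)
      finally show ?thesis .
    qed
    have le: "(cmod (coord (H a x) n))\<^sup>2 \<le> (a\<^sup>2 + 1) * (?p n + ?s (Suc n))" for n
    proof -
      have nn: "0 \<le> a\<^sup>2 * ?s k" for k by simp
      consider "n = 0" | "n = 1" | m where "n = Suc (Suc m)"
        by (metis One_nat_def not0_implies_Suc)
      then show ?thesis
      proof cases
        case 1
        then show ?thesis
          using nn[of 1] by (simp add: H.rep_eq norm_mult norm_divide power_mult_distrib power_divide algebra_simps)
      next
        case 2
        have "4 * (cmod (coord (H a x) n))\<^sup>2 = (cmod (of_real a * coord x 0 + coord x 2))\<^sup>2"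
          using 2 by (simp add: H.rep_eq norm_divide power_divide)
        also have "\<dots> \<le> 2 * (a\<^sup>2 * ?s 0) + 2 * ?s 2"
          using sum2[of "of_real a * coord x 0" "coord x 2"] by (simp add: norm_mult power_mult_distrib)
        finally have "(cmod (coord (H a x) n))\<^sup>2 \<le> a\<^sup>2 * ?s 0 + ?s 0 + a\<^sup>2 * ?s 2 + ?s 2"
          using nn[of 0] nn[of 2] zero_le_power2[of "cmod (coord x 0)"] zero_le_power2[of "cmod (coord x 2)"]
          by linarith
        also have "\<dots> = (a\<^sup>2 + 1) * (?p n + ?s (Suc n))"
          using 2 by (simp add: algebra_simps numeral_2_eq_2)
        finally show ?thesis .
      next
        case 3
        have "4 * (cmod (coord (H a x) n))\<^sup>2 = (cmod (coord x (Suc m) + coord x (Suc n)))\<^sup>2"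
          using 3 by (simp add: H.rep_eq norm_divide power_divide)
        also have "\<dots> \<le> 2 * ?s (Suc m) + 2 * ?s (Suc n)"
          by (rule sum2)
        finally have "(cmod (coord (H a x) n))\<^sup>2 \<le> a\<^sup>2 * ?s (Suc m) + ?s (Suc m) + a\<^sup>2 * ?s (Suc n) + ?s (Suc n)"
          using nn[of "Suc m"] nn[of "Suc n"]
            zero_le_power2[of "cmod (coord x (Suc m))"] zero_le_power2[of "cmod (coord x (Suc n))"]
          by linarith
        also have "\<dots> = (a\<^sup>2 + 1) * (?p n + ?s (Suc n))"
          using 3 by (simp add: algebra_simps)
        finally show ?thesis .
      qed
    qed
    have sm: "summable (\<lambda>n. (a\<^sup>2 + 1) * (?p n + ?s (Suc n)))"
      by (intro summable_mult summable_add q) (rule sums_summable[OF p])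
    have "(\<Sum>n. (cmod (coord (H a x) n))\<^sup>2) \<le> (\<Sum>n. (a\<^sup>2 + 1) * (?p n + ?s (Suc n)))"
      by (rule suminf_le[OF le summable_coord sm])
    also have "\<dots> = (a\<^sup>2 + 1) * (suminf ?s + (\<Sum>n. ?s (Suc n)))"
      using suminf_mult[OF summable_add[OF sums_summable[OF p] q], of "a\<^sup>2 + 1"]
        suminf_add[OF sums_summable[OF p] q] sums_unique[OF p] by simp
    also have "\<dots> \<le> (a\<^sup>2 + 1) * (suminf ?s + suminf ?s)"
      by (intro mult_left_mono add_left_mono q_le) simp
    also have "\<dots> = suminf ?s * (2 * (a\<^sup>2 + 1))"
      by (simp add: algebra_simps)
    finally show ?thesis
      by (simp add: norm_ell2_eq flip: real_sqrt_mult)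
  qed
qed

lemma linear_H_power: "Vector_Spaces.linear cscale cscale (H a ^^ n)"
proof (induction n)
  case 0
  show ?case by (simp add: Vector_Spaces.linear_iff ell2.vector_space_axioms)
next
  case (Suc n)
  then show ?case
    using linear_H[of a] by (simp add: Vector_Spaces.linear_iff)
qed

lemma coord_H_power_diff_eq_0:
  "k > n \<Longrightarrow> coord ((H a ^^ n) x - (H 1 ^^ n) x) k = 0"
proof (induction n arbitrary: k)
  case (Suc n)
  then have "coord ((H a ^^ n) x) (k - 1) = coord ((H 1 ^^ n) x) (k - 1)"
    "coord ((H a ^^ n) x) (k + 1) = coord ((H 1 ^^ n) x) (k + 1)" if "k \<ge> 2"
    using Suc.IH[of "k - 1"] Suc.IH[of "k + 1"] that by auto
  moreover have "coord (H a y) 1 - coord (H 1 y') 1 = ((a - 1) * coord y 0) / 2"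
    if "y = y'" for y y'
    using that by (simp add: H.rep_eq algebra_simps add_divide_distrib diff_divide_distrib)
  ultimately show ?case
    using Suc.prems by (cases "k \<ge> 2") (auto simp: H.rep_eq)
qed simp

lemma coord_sum [simp]: "coord (sum f A) n = (\<Sum>i\<in>A. coord (f i) n)"
  by (induction A rule: infinite_finite_induct) auto

lemma finite_rank_H_power_diff: "finite_rank (\<lambda>x. (H a ^^ n) x - (H 1 ^^ n) x)"
proof -
  let ?T = "\<lambda>x. (H a ^^ n) x - (H 1 ^^ n) x"
  have "Vector_Spaces.linear cscale cscale ?T"
    using linear_H_power[where a = a and n = n] linear_H_power[where a = 1 and n = n]
    by (simp add: Vector_Spaces.linear_iff ell2.scale_right_diff_distrib)
  moreover have "?T x \<in> cspan (basis_vec ` {..n})" for x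
  proof -
    have "?T x = (\<Sum>k\<le>n. cscale (coord (?T x) k) (basis_vec k))"
    proof (rule ell2_eqI)
      fix m
      show "coord (?T x) m = coord (\<Sum>k\<le>n. cscale (coord (?T x) k) (basis_vec k)) m"
        using coord_H_power_diff_eq_0[where n = n and k = m and a = a and x = x]
        by (cases "m \<le> n") (auto simp: if_distrib cong: if_cong)
    qed
    also have "\<dots> \<in> cspan (basis_vec ` {..n})"
      by (intro ell2.span_sum ell2.span_scale ell2.span_base) auto
    finally show ?thesis .
  qed
  ultimately show ?thesis
    unfolding finite_rank_def by (meson finite_atMost finite_imageI image_subsetI)
qed

lemma summable_trace_H_power_diff:
  "summable (\<lambda>k. cinner ((H a ^^ n) (basis_vec k) - (H 1 ^^ n) (basis_vec k)) (basis_vec k))"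
  unfolding cinner_basis_vec
  by (rule summable_finite[of "{..n}"]) (auto simp del: coord_simps intro!: coord_H_power_diff_eq_0)


section \<open>The generating function\<close>

(* Re (1 - z^2) > 0 on the unit disc, so the principal square root is the required branch. *)
lemma csqrt_branch:
  "(\<lambda>z. csqrt (1 - z\<^sup>2)) holomorphic_on ball 0 1"
  "(csqrt (1 - z\<^sup>2))\<^sup>2 = 1 - z\<^sup>2"
  "csqrt (1 - 0\<^sup>2) = 1"
proof -
  have "1 - z\<^sup>2 \<notin> \<real>\<^sub>\<le>\<^sub>0" if "z \<in> ball 0 1" for z :: complex
  proof -
    have "Re (z\<^sup>2) \<le> (cmod z)\<^sup>2"
      using complex_Re_le_cmod[of "z\<^sup>2"] by (simp add: norm_power)
    also have "\<dots> < 1"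
      using that by (simp add: power_less_one_iff abs_square_less_1)
    finally show ?thesis
      by (auto simp: complex_nonpos_Reals_iff)
  qed
  then show "(\<lambda>z. csqrt (1 - z\<^sup>2)) holomorphic_on ball 0 1"
    by (intro holomorphic_intros) auto
qed simp_all

definition trace_gf_formula :: "real \<Rightarrow> complex \<Rightarrow> complex" where
  "trace_gf_formula a z =
    2 * (of_real a ^ 2 - 1) / csqrt (1 - z\<^sup>2) *
    ((1 - csqrt (1 - z\<^sup>2))\<^sup>2 / (z\<^sup>2 + (1 - of_real a ^ 2) * (1 - csqrt (1 - z\<^sup>2))\<^sup>2))"

(* The formula is of the form 0 / 0 at z = 0, where it is replaced by its limit. *)
definition trace_gf :: "real \<Rightarrow> complex \<Rightarrow> complex" where
  "trace_gf a z = (if z = 0 then Lim (at 0) (trace_gf_formula a) else trace_gf_formula a z)"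

lemma trace_gf_formula_tendsto_0: "trace_gf_formula a \<midarrow>0\<rightarrow> 0"
proof -
  let ?c = "1 - of_real a ^ 2 :: complex"
  let ?s = "\<lambda>z::complex. csqrt (1 - z\<^sup>2)"
  have s_tendsto: "?s \<midarrow>0\<rightarrow> ?s 0"
    using holomorphic_on_imp_continuous_on[OF csqrt_branch(1)]
    unfolding continuous_on_eq_continuous_at[OF open_ball] isCont_def
    by (rule bspec) simp
  have "(\<lambda>z. - 2 * ?c / ?s z * ((1 - ?s z) / (1 + ?s z + ?c * (1 - ?s z)))) \<midarrow>0\<rightarrow>
      - 2 * ?c / ?s 0 * ((1 - ?s 0) / (1 + ?s 0 + ?c * (1 - ?s 0)))"
    by (intro tendsto_intros s_tendsto) auto
  moreover have "trace_gf_formula a = (\<lambda>z. - 2 * ?c / ?s z * ((1 - ?s z) / (1 + ?s z + ?c * (1 - ?s z))))"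
  proof
    fix z :: complex
    have "z\<^sup>2 = (1 - ?s z) * (1 + ?s z)"
      using csqrt_branch(2)[of z] by (simp add: algebra_simps power2_eq_square)
    then have "z\<^sup>2 + ?c * (1 - ?s z)\<^sup>2 = (1 - ?s z) * (1 + ?s z + ?c * (1 - ?s z))"
      by (simp add: algebra_simps power2_eq_square)
    moreover have "(1 - ?s z)\<^sup>2 / ((1 - ?s z) * w) = (1 - ?s z) / w" for w
      by (simp add: power2_eq_square)
    ultimately show "trace_gf_formula a z = - 2 * ?c / ?s z * ((1 - ?s z) / (1 + ?s z + ?c * (1 - ?s z)))"
      unfolding trace_gf_formula_def by (simp only:) (simp add: algebra_simps)
  qed
  ultimately show ?thesis
    by simp
qed

end

theory Submission
  imports Defs "HOL-Complex_Analysis.Complex_Analysis"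
begin

text \<open>
  Under the substitution \<open>z = 2 q / (1 + q\<^sup>2)\<close>, i.e. \<open>q = z / (1 + sqrt (1 - z\<^sup>2))\<close>, the resolvent
  \<open>(1 - z H\<^sub>a)\<^sup>-\<^sup>1\<close> has an explicit kernel built from \<open>q\<^sup>n\<close> and \<open>q\<^sup>-\<^sup>n\<close>, and its
  diagonal differs from the one for \<open>a = 1\<close> by a geometric sequence. For small \<open>z\<close> the Neumann
  series identifies the generating function of the traces with the sum of that sequence. The closed
  form is holomorphic on the whole disc of the theorem, because with \<open>s = sqrt (1 - z\<^sup>2)\<close> its
  denominator reduces to \<open>s (2 - a\<^sup>2 + a\<^sup>2 s)\<close>; so its Taylor series, whose coefficients
  are the traces, converges there.
\<close>

section \<open>Interchange of summation for triangular arrays\<close>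

text \<open>Needed to exchange the power series in \<open>n\<close> with the trace sum over
  \<open>k\<close>. The bound alone gives no decay in \<open>k\<close>; together with triangularity
  it yields absolute summability over all pairs, so summing by rows and by columns gives the same
  value.\<close>

lemma sums_triangle_swap:
  fixes b :: "nat \<Rightarrow> nat \<Rightarrow> complex"
  assumes t: "0 \<le> t" "t < 1"
    and bound: "\<And>n k. norm (b n k) \<le> C * t ^ n"
    and zero: "\<And>n k. n < k \<Longrightarrow> b n k = 0"
    and col: "\<And>k. (\<lambda>n. b n k) sums g k"
    and g: "g sums G"
  shows "(\<lambda>n. \<Sum>k\<le>n. b n k) sums G"
proof -
  define r where "r = sqrt t"
  have r: "0 \<le> r" "r < 1" "t = r * r"
    using t by (auto simp: r_def)
  have C: "C \<ge> 0"
    using order_trans[OF norm_ge_zero bound[of 0 0]] by simp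
  \<comment> \<open>Since \<open>b n k\<close> vanishes for \<open>k > n\<close>, half of the decay in \<open>n\<close> can be spent on \<open>k\<close>.\<close>
  have le: "norm (b n k) \<le> C * r ^ n * r ^ k" for n k
  proof (cases "n < k")
    case False
    have "norm (b n k) \<le> C * r ^ n * r ^ n"
      using bound[of n k] by (simp add: r(3) power_mult_distrib mult.assoc)
    also have "\<dots> \<le> C * r ^ n * r ^ k"
      using False r C by (intro mult_left_mono power_decreasing) auto
    finally show ?thesis .
  qed (use r C zero in auto)
  have geo: "(\<lambda>n. c * r ^ n) sums (c * (1 / (1 - r)))" for c
    using r by (intro sums_mult geometric_sums) auto
  have geo': "((\<lambda>n. c * r ^ n) has_sum (c * (1 / (1 - r)))) UNIV" if "c \<ge> 0" for c
    using geo[of c] r that by (intro norm_summable_imp_has_sum) (auto simp: sums_iff)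
  have "(\<lambda>(n, k). C * r ^ n * r ^ k) summable_on (UNIV \<times> UNIV)"
  proof (rule summable_on_SigmaI)
    show "((\<lambda>k. case (n, k) of (n, k) \<Rightarrow> C * r ^ n * r ^ k) has_sum C * r ^ n * (1 / (1 - r))) UNIV" for n
      using geo'[of "C * r ^ n"] r C by simp
    show "(\<lambda>n. C * r ^ n * (1 / (1 - r))) summable_on UNIV"
      using has_sum_cmult_left[OF geo'[OF C], of "1 / (1 - r)"] by (auto simp: summable_on_def)
  qed (use r C in auto)
  then have "(\<lambda>p. norm (case p of (n, k) \<Rightarrow> b n k)) summable_on (UNIV \<times> UNIV)"
    by (rule Infinite_Sum.abs_summable_on_comparison_test') (use le in auto)
  then obtain T where T: "((\<lambda>(n, k). b n k) has_sum T) (UNIV \<times> UNIV)"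
    using Infinite_Sum.abs_summable_summable summable_on_def by blast
  have row: "((\<lambda>k. b n k) has_sum (\<Sum>k\<le>n. b n k)) UNIV" for n
    by (rule has_sum_finite_neutralI) (use zero in \<open>auto simp: not_le\<close>)
  have "((\<lambda>n. \<Sum>k\<le>n. b n k) has_sum T) UNIV"
    using row by (intro has_sum_SigmaD[OF T]) auto
  moreover have "(g has_sum T) UNIV"
  proof (rule has_sum_SigmaD)
    show "((\<lambda>(k, n). b n k) has_sum T) (UNIV \<times> UNIV)"
      using has_sum_swap[THEN iffD1, OF T] by simp
    have "summable (\<lambda>n. norm (b n k))" for k
      by (rule summable_comparison_test'[of "\<lambda>n. C * t ^ n"])
        (use t bound in \<open>auto intro!: summable_mult summable_geometric\<close>)
    then show "((\<lambda>n. case (k, n) of (k, n) \<Rightarrow> b n k) has_sum g k) UNIV" for k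
      using col by (auto intro: norm_summable_imp_has_sum)
  qed
  ultimately show ?thesis
    using has_sum_imp_sums sums_unique2[OF g] by metis
qed

section \<open>The three-term recurrence on sequences and its Neumann series\<close>

text \<open>The action of \<open>H a\<close> on coordinates, freed from square summability:
  resolvent columns can then be treated as bounded sequences, with sup-norm estimates.\<close>

definition jacobi :: "real \<Rightarrow> (nat \<Rightarrow> complex) \<Rightarrow> nat \<Rightarrow> complex" where
  "jacobi a x n = (if n = 0 then complex_of_real (a / 2) * x 1
      else if n = 1 then (complex_of_real a * x 0 + x 2) / 2
      else (x (n - 1) + x (n + 1)) / 2)"

lemma coord_H: "coord (H a x) = jacobi a (coord x)"
  by (rule ext) (simp add: H.rep_eq jacobi_def)

lemma coord_H_power: "coord ((H a ^^ n) x) = (jacobi a ^^ n) (coord x)"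
  by (induction n) (simp_all add: coord_H)

lemma jacobi_add_scale: "jacobi a (\<lambda>n. x n + c * y n) = (\<lambda>n. jacobi a x n + c * jacobi a y n)"
  by (rule ext) (simp add: jacobi_def algebra_simps add_divide_distrib)

text \<open>The absolute row sums are \<open>\<bar>a\<bar> / 2\<close>,
  \<open>(\<bar>a\<bar> + 1) / 2\<close> and \<open>1\<close>. The common bound is crude, but it
  only serves to get convergence for small \<open>z\<close>.\<close>

lemma norm_jacobi_le:
  assumes "\<And>n. norm (x n) \<le> M"
  shows "norm (jacobi a x n) \<le> (\<bar>a\<bar> + 1) * M"
proof -
  have M: "0 \<le> M"
    using order_trans[OF norm_ge_zero assms] .
  have ax: "norm (complex_of_real a * x k) \<le> \<bar>a\<bar> * M" for k
    using assms by (simp add: norm_mult mult_left_mono)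
  have aM: "0 \<le> \<bar>a\<bar> * M"
    using M by simp
  consider "n = 0" | "n = 1" | "n \<ge> 2" by linarith
  then show ?thesis
  proof cases
    case 1
    have "norm (jacobi a x n) = norm (complex_of_real a * x 1) / 2"
      using 1 by (simp add: jacobi_def norm_mult norm_divide)
    also have "\<dots> \<le> (\<bar>a\<bar> + 1) * M"
      using ax[of 1] aM M norm_ge_zero[of "complex_of_real a * x 1"] unfolding distrib_right by linarith
    finally show ?thesis .
  next
    case 2
    have "norm (complex_of_real a * x 0 + x 2) \<le> \<bar>a\<bar> * M + M"
      by (intro norm_triangle_mono ax assms)
    moreover have "norm (jacobi a x n) = norm (complex_of_real a * x 0 + x 2) / 2"
      using 2 by (simp add: jacobi_def norm_divide)
    ultimately show ?thesis
      using aM M unfolding distrib_right by linarith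
  next
    case 3
    have "norm (x (n - 1) + x (n + 1)) \<le> M + M"
      by (intro norm_triangle_mono assms)
    moreover have "norm (jacobi a x n) = norm (x (n - 1) + x (n + 1)) / 2"
      using 3 by (simp add: jacobi_def norm_divide)
    ultimately show ?thesis
      using aM M unfolding distrib_right by linarith
  qed
qed

lemma norm_jacobi_power_le:
  assumes "\<And>n. norm (x n) \<le> M"
  shows "norm ((jacobi a ^^ m) x n) \<le> (\<bar>a\<bar> + 1) ^ m * M"
proof (induction m arbitrary: n)
  case (Suc m)
  then show ?case
    using norm_jacobi_le[of "(jacobi a ^^ m) x" "(\<bar>a\<bar> + 1) ^ m * M" a n] by (simp add: mult.assoc)
qed (use assms in auto)

lemma jacobi_power_add_scale:
  "(jacobi a ^^ m) (\<lambda>n. x n + c * y n) = (\<lambda>n. (jacobi a ^^ m) x n + c * (jacobi a ^^ m) y n)"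
  by (induction m) (simp_all add: jacobi_add_scale)

text \<open>Iterating the fixed-point equation \<open>N\<close> times leaves the remainder
  \<open>z ^ N * (jacobi a ^^ N) u j\<close>, which tends to 0 because \<open>u\<close> is bounded.
  Hence an explicit bounded solution is identified with the Neumann series without constructing an
  inverse operator.\<close>

lemma jacobi_neumann_series:
  assumes z: "norm z * (\<bar>a\<bar> + 1) < 1"
    and bounded: "\<And>n. norm (u n) \<le> M"
    and fixpoint: "\<And>n. u n = y n + z * jacobi a u n"
  shows "(\<lambda>m. z ^ m * (jacobi a ^^ m) y j) sums u j"
proof -
  have u: "u = (\<lambda>n. y n + z * jacobi a u n)"
    using fixpoint by blast
  have step: "(jacobi a ^^ m) u j = (jacobi a ^^ m) y j + z * (jacobi a ^^ Suc m) u j" for m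
    by (subst (1) u) (simp add: jacobi_power_add_scale funpow_swap1)
  have partial: "(\<Sum>m<N. z ^ m * (jacobi a ^^ m) y j) = u j - z ^ N * (jacobi a ^^ N) u j" for N
  proof (induction N)
    case (Suc N)
    then show ?case
      using step[of N] by (simp add: algebra_simps del: funpow.simps)
  qed simp
  have "(\<lambda>N. z ^ N * (jacobi a ^^ N) u j) \<longlonglongrightarrow> 0"
  proof (rule Lim_null_comparison)
    show "\<forall>\<^sub>F N in sequentially. norm (z ^ N * (jacobi a ^^ N) u j) \<le> (norm z * (\<bar>a\<bar> + 1)) ^ N * M"
      using norm_jacobi_power_le[OF bounded, where a = a]
      by (intro always_eventually)
        (auto simp: norm_mult norm_power power_mult_distrib mult.assoc intro: mult_left_mono)
    have "(\<lambda>N. (norm z * (\<bar>a\<bar> + 1)) ^ N) \<longlonglongrightarrow> 0"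
      using z by (intro LIMSEQ_power_zero) simp
    then show "(\<lambda>N. (norm z * (\<bar>a\<bar> + 1)) ^ N * M) \<longlonglongrightarrow> 0"
      by (rule tendsto_mult_left_zero)
  qed
  then show ?thesis
    unfolding sums_def partial using tendsto_diff[OF tendsto_const, of _ 0 sequentially "u j"] by simp
qed

text \<open>Only neighbouring indices are coupled, so each application flips the parity of the
  support.\<close>

lemma jacobi_power_parity:
  assumes "\<And>j. odd (j + k) \<Longrightarrow> x j = 0" and "odd (m + j + k)"
  shows "(jacobi a ^^ m) x j = 0"
  using assms(2)
proof (induction m arbitrary: j)
  case (Suc m)
  \<comment> \<open>Index 0 is set apart because there \<open>j - 1\<close> truncates to 0 and has
    the wrong parity; row 0 only looks at index 1.\<close>
  have "j = 0 \<or> odd (m + (j - 1) + k)" "odd (m + (j + 1) + k)"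
    using Suc.prems by (cases j; auto)+
  then have "j = 0 \<or> (jacobi a ^^ m) x (j - 1) = 0" "(jacobi a ^^ m) x (j + 1) = 0"
    using Suc.IH by blast+
  then show ?case
    by (auto simp: jacobi_def[of a "(jacobi a ^^ m) x"] numeral_2_eq_2)
qed (use assms(1) in auto)

section \<open>Explicit resolvent kernel\<close>

text \<open>Column \<open>k\<close> of \<open>(1 - z H\<^sub>a)\<^sup>-\<^sup>1\<close> at \<open>z = 2 q / (1 + q\<^sup>2)\<close>: the solution decaying like
  \<open>q\<^sup>n\<close> times the solution regular at \<open>0\<close>, divided by their Wronskian.\<close>

definition jacobi_green :: "real \<Rightarrow> complex \<Rightarrow> nat \<Rightarrow> nat \<Rightarrow> complex" where
  "jacobi_green a q k n = (let D = 1 + (1 - (of_real a)\<^sup>2) * q\<^sup>2 in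
     if k = 0 then (1 + q\<^sup>2) / D * (if n = 0 then 1 else of_real a * q ^ n)
     else if n = 0 then of_real a * (1 + q\<^sup>2) / D * q ^ k
     else (1 + q\<^sup>2) / (1 - q\<^sup>2) *
       ((if n \<le> k then q ^ (k - n) else q ^ (n - k)) + ((of_real a)\<^sup>2 - 1 - q\<^sup>2) / D * q ^ (n + k)))"

text \<open>After multiplication by \<open>P = 1 + q\<^sup>2\<close> the equation is a polynomial
  recurrence in \<open>q\<close>. It is checked in three regimes: the rows near 0, where
  \<open>A\<close> acts as a reflection coefficient, the rows off the diagonal, and the diagonal
  row, which produces the 1.\<close>

lemma jacobi_green_fixpoint:
  assumes q: "1 + q\<^sup>2 \<noteq> 0" "1 - q\<^sup>2 \<noteq> 0" and D: "1 + (1 - (of_real a)\<^sup>2) * q\<^sup>2 \<noteq> 0"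
  shows "jacobi_green a q k n =
    (if n = k then 1 else 0) + 2 * q / (1 + q\<^sup>2) * jacobi a (jacobi_green a q k) n"
proof -
  define \<alpha> D P S A where "\<alpha> = complex_of_real a" and "D = 1 + (1 - \<alpha>\<^sup>2) * q\<^sup>2" and "P = 1 + q\<^sup>2"
    and "S = P / (1 - q\<^sup>2)" and "A = (\<alpha>\<^sup>2 - 1 - q\<^sup>2) / D"
  have nz: "P \<noteq> 0" "1 - q\<^sup>2 \<noteq> 0" "D \<noteq> 0"
    using q D by (simp_all add: \<alpha>_def D_def P_def)
  have G: "jacobi_green a q k n = (if k = 0 then P / D * (if n = 0 then 1 else \<alpha> * q ^ n)
     else if n = 0 then \<alpha> * P / D * q ^ k
     else S * ((if n \<le> k then q ^ (k - n) else q ^ (n - k)) + A * q ^ (n + k)))" for k n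
    by (simp add: jacobi_green_def \<alpha>_def D_def P_def S_def A_def Let_def)
  have J: "jacobi a x n = (if n = 0 then \<alpha> / 2 * x 1 else if n = 1 then (\<alpha> * x 0 + x 2) / 2
      else (x (n - 1) + x (n + 1)) / 2)" for x n
    by (simp add: jacobi_def \<alpha>_def)
  have SP: "S * (1 - q\<^sup>2) = P" and AD: "A * D = \<alpha>\<^sup>2 - 1 - q\<^sup>2"
    using nz by (simp_all add: S_def A_def)
  \<comment> \<open>The matching conditions at the boundary: the first relates the entry at 0 to the
    free solution extended to index 0, the second is row 0 itself.\<close>
  have "S * (1 + A) * D = \<alpha>\<^sup>2 * P" "S * (1 + A * q\<^sup>2) * D = P * P"
    using SP AD D_def P_def by algebra+
  then have S0: "\<alpha>\<^sup>2 * P / D = S * (1 + A)" and S1: "P * P / D = S * (1 + A * q\<^sup>2)"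
    using nz by (simp_all add: field_simps)
  have "P * jacobi_green a q k n = (if n = k then P else 0) + 2 * q * jacobi a (jacobi_green a q k) n"
  proof (cases "k = 0")
    case True
    consider "n = 0" | "n = 1" | m where "n = Suc (Suc m)"
      by (metis One_nat_def not0_implies_Suc)
    then show ?thesis
    proof cases
      case 1
      have "P * P = P * D + q\<^sup>2 * \<alpha>\<^sup>2 * P"
        by (simp add: D_def P_def power2_eq_square algebra_simps)
      with 1 True nz show ?thesis
        by (simp add: G J field_simps power2_eq_square)
    next
      case 2
      with True nz show ?thesis
        by (simp add: G J field_simps) (simp add: P_def power2_eq_square algebra_simps)
    next
      case 3
      with True nz show ?thesis
        by (simp add: G J field_simps) (simp add: P_def power2_eq_square algebra_simps)
    qed
  next
    case False
    then obtain l where k: "k = Suc l"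
      by (cases k) auto
    define f where
      "f m = S * ((if m \<le> k then q ^ (k - m) else q ^ (m - k)) + A * q ^ (m + k))" for m
    have G_Suc: "jacobi_green a q k (Suc m) = f (Suc m)" for m
      using False by (simp add: G f_def)
    have "\<alpha> * jacobi_green a q k 0 = \<alpha>\<^sup>2 * P / D * q ^ k"
      using False by (simp add: G power2_eq_square)
    then have G_0: "\<alpha> * jacobi_green a q k 0 = f 0"
      unfolding S0 by (simp add: f_def algebra_simps)
    \<comment> \<open>Replacing the value at \<open>0\<close> by \<open>\<alpha>\<close> times it turns every row but the first into the free recurrence.\<close>
    show ?thesis
    proof (cases n)
      case 0
      have "P * jacobi_green a q k 0 = \<alpha> * (P * P / D) * q ^ k"
        using False by (simp add: G)
      also have "\<dots> = q * \<alpha> * f 1"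
        unfolding S1 by (simp add: f_def k power2_eq_square algebra_simps)
      finally show ?thesis
        using 0 False G_Suc[of 0] by (simp add: J)
    next
      case (Suc m)
      have "2 * q * jacobi a (jacobi_green a q k) n = q * (f m + f (Suc (Suc m)))"
        using Suc G_Suc[of 0] G_Suc[of 1] G_Suc[of "m - 1"] G_Suc[of "Suc m"] G_0
        by (cases m) (simp_all add: J numeral_2_eq_2)
      \<comment> \<open>Off the diagonal both terms of \<open>f\<close> solve the free recurrence,
        since \<open>P * q ^ j = q * (q ^ (j - 1) + q ^ (j + 1))\<close> for
        \<open>j > 0\<close>.\<close>
      moreover have "P * f (Suc m) = (if Suc m = k then P else 0) + q * (f m + f (Suc (Suc m)))"
      proof (cases "Suc m" k rule: linorder_cases)
        case less
        then obtain d where "k = Suc d + Suc m"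
          by (metis add.commute add_Suc less_imp_Suc_add)
        then show ?thesis
          by (simp add: f_def P_def power2_eq_square power_add algebra_simps)
      next
        case equal
        \<comment> \<open>On the diagonal both neighbours carry the factor \<open>q\<close> in the
          first term, so the recurrence misses by \<open>S * (1 - q\<^sup>2)\<close>, which is
          \<open>P\<close> by the choice of \<open>S\<close>.\<close>
        have "P * (S * (1 + A * X * q * q)) =
            S * (1 - q\<^sup>2) + q * (S * (q + A * X * q) + S * (q + A * X * q * q * q))" for X
          by (simp add: P_def power2_eq_square algebra_simps)
        from this[of "q ^ (m + m)", unfolded SP] equal show ?thesis
          by (auto simp: f_def power_add mult_ac)
      next
        case greater
        then obtain d where "m = d + k"
          by (metis add.commute le_Suc_ex less_Suc_eq_le)
        then show ?thesis
          by (simp add: f_def P_def Suc_diff_le power2_eq_square power_add algebra_simps)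
      qed
      ultimately show ?thesis
        using Suc G_Suc[of m] by auto
    qed
  qed
  then show ?thesis
    using nz by (simp add: P_def field_simps)
qed

text \<open>All exponents of \<open>q\<close> in the kernel are nonnegative, so every power has norm
  at most 1. This supplies the boundedness required by the Neumann series.\<close>

lemma jacobi_green_bounded:
  assumes q: "norm q < 1"
  obtains M where "\<And>n. norm (jacobi_green a q k n) \<le> M"
proof -
  define D P S A where "D = 1 + (1 - (complex_of_real a)\<^sup>2) * q\<^sup>2" and "P = 1 + q\<^sup>2"
    and "S = P / (1 - q\<^sup>2)" and "A = ((complex_of_real a)\<^sup>2 - 1 - q\<^sup>2) / D"
  have G: "jacobi_green a q k n = (if k = 0 then P / D * (if n = 0 then 1 else of_real a * q ^ n)
     else if n = 0 then P / D * (of_real a * q ^ k)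
     else S * ((if n \<le> k then q ^ (k - n) else q ^ (n - k)) + A * q ^ (n + k)))" for n
    by (simp add: jacobi_green_def D_def P_def S_def A_def Let_def)
  have pw: "norm (q ^ m) \<le> 1" for m
    using q by (simp add: norm_power power_le_one)
  have aq: "norm (of_real a * q ^ m) \<le> 1 + \<bar>a\<bar>" for m
    using mult_left_mono[OF pw[of m], of "\<bar>a\<bar>"] by (simp add: norm_mult)
  have "norm (A * q ^ m) \<le> norm A" for m
    using mult_left_mono[OF pw[of m], of "norm A"] by (simp add: norm_mult)
  then have Aq: "norm (q ^ l + A * q ^ m) \<le> 1 + norm A" for l m
    using pw by (intro norm_triangle_mono)
  have "norm (jacobi_green a q k n) \<le> norm (P / D) * (1 + \<bar>a\<bar>) + norm S * (1 + norm A)" for n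
  proof (cases "k = 0 \<or> n = 0")
    case True
    \<comment> \<open>The entries of row 0 and column 0 share one formula in
      \<open>n + k\<close>.\<close>
    then have "jacobi_green a q k n = P / D * (if n + k = 0 then 1 else of_real a * q ^ (n + k))"
      by (auto simp: G)
    also have "norm \<dots> \<le> norm (P / D) * (1 + \<bar>a\<bar>)"
      unfolding norm_mult using aq by (intro mult_left_mono) auto
    finally have "norm (jacobi_green a q k n) \<le> norm (P / D) * (1 + \<bar>a\<bar>)" .
    then show ?thesis
      by (rule order_trans) (simp add: add_nonneg_nonneg)
  next
    case False
    then have "norm (jacobi_green a q k n) \<le> norm S * (1 + norm A)"
      using Aq by (auto simp: G norm_mult intro!: mult_left_mono)
    then show ?thesis
      by (rule order_trans) (simp add: add_nonneg_nonneg)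
  qed
  then show ?thesis
    by (rule that)
qed

lemma jacobi_green_sums:
  assumes q: "norm q < 1" and z: "z = 2 * q / (1 + q\<^sup>2)" "norm z * (\<bar>a\<bar> + 1) < 1"
    and D: "1 + (1 - (of_real a)\<^sup>2) * q\<^sup>2 \<noteq> 0"
  shows "(\<lambda>n. z ^ n * coord ((H a ^^ n) (basis_vec k)) j) sums jacobi_green a q k j"
proof -
  have "norm (q\<^sup>2) < 1"
    using q by (simp add: norm_power power_less_one_iff abs_square_less_1)
  then have nz: "1 + q\<^sup>2 \<noteq> 0" "1 - q\<^sup>2 \<noteq> 0"
    by (auto simp: add_eq_0_iff dest: arg_cong[of _ _ norm])
  obtain M where "\<And>n. norm (jacobi_green a q k n) \<le> M"
    using jacobi_green_bounded[OF q] by blast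
  then show ?thesis
    unfolding coord_H_power
    by (rule jacobi_neumann_series[OF z(2)])
      (simp only: coord_basis_vec z(1), rule jacobi_green_fixpoint[OF nz D])
qed

section \<open>Diagonal of the resolvent difference\<close>

text \<open>The free parts cancel. At parameter 1 the reflection coefficient is
  \<open>- q\<^sup>2\<close>, so for \<open>k > 0\<close> what remains is the difference of two
  reflection coefficients times \<open>(q\<^sup>2) ^ k\<close>.\<close>

lemma jacobi_green_diag_diff:
  assumes "1 - q\<^sup>2 \<noteq> 0" and "D = 1 + (1 - (of_real a)\<^sup>2) * q\<^sup>2" "D \<noteq> 0"
  shows "jacobi_green a q k k - jacobi_green 1 q k k =
    (if k = 0 then (1 + q\<^sup>2) * q\<^sup>2 else (1 + q\<^sup>2)\<^sup>2 * (q\<^sup>2) ^ k) * ((of_real a)\<^sup>2 - 1) / D"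
proof (cases "k = 0")
  case True
  have "(1 + q\<^sup>2) / D - (1 + q\<^sup>2) = (1 + q\<^sup>2) * q\<^sup>2 * ((of_real a)\<^sup>2 - 1) / D"
    using assms(3) by (simp add: field_simps) (simp add: assms(2) algebra_simps)
  with True show ?thesis
    by (simp add: jacobi_green_def assms(2))
next
  case False
  have "(of_real a)\<^sup>2 - 1 - q\<^sup>2 + q\<^sup>2 * D = (1 + q\<^sup>2) * (1 - q\<^sup>2) * ((of_real a)\<^sup>2 - 1)"
    unfolding assms(2) by (simp add: algebra_simps power2_eq_square)
  then have "((of_real a)\<^sup>2 - 1 - q\<^sup>2) / D + q\<^sup>2 = (1 + q\<^sup>2) * (1 - q\<^sup>2) * ((of_real a)\<^sup>2 - 1) / D"
    using assms(3) by (metis add_divide_distrib nonzero_mult_div_cancel_right)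
  then have "(1 + q\<^sup>2) / (1 - q\<^sup>2) * (((of_real a)\<^sup>2 - 1 - q\<^sup>2) / D + q\<^sup>2) * (q\<^sup>2) ^ k
      = (1 + q\<^sup>2)\<^sup>2 * (q\<^sup>2) ^ k * ((of_real a)\<^sup>2 - 1) / D"
    using assms(1) by (simp add: power2_eq_square)
  moreover have "jacobi_green b q k k = (1 + q\<^sup>2) / (1 - q\<^sup>2) *
      (1 + ((of_real b)\<^sup>2 - 1 - q\<^sup>2) / (1 + (1 - (of_real b)\<^sup>2) * q\<^sup>2) * (q\<^sup>2) ^ k)" for b
    using False by (simp add: jacobi_green_def Let_def flip: power_mult mult_2)
  from this[of a] this[of 1]
  have "jacobi_green a q k k - jacobi_green 1 q k k =
      (1 + q\<^sup>2) / (1 - q\<^sup>2) * (((of_real a)\<^sup>2 - 1 - q\<^sup>2) / D + q\<^sup>2) * (q\<^sup>2) ^ k"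
    unfolding assms(2)[symmetric]
    by (simp only: of_real_1 power_one diff_self mult_zero_left add_0_right div_by_1 diff_0 flip: right_diff_distrib)
      (simp add: distrib_right)
  ultimately show ?thesis
    using False by simp
qed

lemma jacobi_green_diag_diff_sums:
  assumes q: "norm q < 1" and D: "D = 1 + (1 - (of_real a)\<^sup>2) * q\<^sup>2" "D \<noteq> 0"
  shows "(\<lambda>k. jacobi_green a q k k - jacobi_green 1 q k k) sums
    (2 * ((of_real a)\<^sup>2 - 1) * (1 + q\<^sup>2) * q\<^sup>2 / (D * (1 - q\<^sup>2)))"
proof -
  let ?E = "((of_real a)\<^sup>2 - 1) / D"
  have q2: "norm (q\<^sup>2) < 1"
    using q by (simp add: norm_power power_less_one_iff abs_square_less_1)
  then have nz: "1 - q\<^sup>2 \<noteq> 0"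
    by auto
  have "(\<lambda>k. (1 + q\<^sup>2)\<^sup>2 * q\<^sup>2 * ?E * (q\<^sup>2) ^ k) sums ((1 + q\<^sup>2)\<^sup>2 * q\<^sup>2 * ?E * (1 / (1 - q\<^sup>2)))"
    by (intro sums_mult geometric_sums q2)
  then have "(\<lambda>k. jacobi_green a q (Suc k) (Suc k) - jacobi_green 1 q (Suc k) (Suc k)) sums
      ((1 + q\<^sup>2)\<^sup>2 * q\<^sup>2 * ?E * (1 / (1 - q\<^sup>2)))"
    by (simp add: jacobi_green_diag_diff[OF nz D] mult_ac)
  \<comment> \<open>The entry \<open>k = 0\<close> does not fit the geometric pattern and is added
    separately.\<close>
  then have "(\<lambda>k. jacobi_green a q k k - jacobi_green 1 q k k) sums
      ((1 + q\<^sup>2)\<^sup>2 * q\<^sup>2 * ?E * (1 / (1 - q\<^sup>2)) + (1 + q\<^sup>2) * q\<^sup>2 * ?E)"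
    by (subst (asm) sums_Suc_iff) (simp add: jacobi_green_diag_diff[OF nz D])
  also have "(1 + q\<^sup>2)\<^sup>2 * q\<^sup>2 * ?E * (1 / (1 - q\<^sup>2)) + (1 + q\<^sup>2) * q\<^sup>2 * ?E =
      2 * ((of_real a)\<^sup>2 - 1) * (1 + q\<^sup>2) * q\<^sup>2 / (D * (1 - q\<^sup>2))"
    using nz D(2) by (simp add: field_simps power2_eq_square)
  finally show ?thesis .
qed

section \<open>Traces and their generating function for small arguments\<close>

lemma trace_H_power_diff:
  "ell2_trace (\<lambda>x. (H a ^^ n) x - (H 1 ^^ n) x) =
    (\<Sum>k\<le>n. coord ((H a ^^ n) (basis_vec k)) k - coord ((H 1 ^^ n) (basis_vec k)) k)"
  unfolding ell2_trace_def cinner_basis_vec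
  by (subst suminf_finite[of "{..n}"])
    (use coord_H_power_diff_eq_0[of n _ a "basis_vec _"] in auto)

text \<open>By parity, an odd power of either operator already has zero diagonal.\<close>

lemma trace_H_power_diff_odd:
  assumes "odd n"
  shows "ell2_trace (\<lambda>x. (H a ^^ n) x - (H 1 ^^ n) x) = 0"
proof -
  have "coord ((H b ^^ n) (basis_vec k)) k = 0" for b k
    unfolding coord_H_power using assms by (intro jacobi_power_parity[where k = k]) auto
  then show ?thesis
    by (simp add: trace_H_power_diff)
qed

text \<open>Column sums of the triangular array are the diagonal resolvent differences, row sums are
  the traces. The constant \<open>max \<bar>a\<bar> 1 + 1\<close> dominates the growth rates for
  both parameters \<open>a\<close> and 1.\<close>

lemma trace_H_power_diff_sums_small:
  assumes q: "norm q < 1" and z: "z = 2 * q / (1 + q\<^sup>2)" "norm z * (max \<bar>a\<bar> 1 + 1) < 1"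
    and D: "D = 1 + (1 - (of_real a)\<^sup>2) * q\<^sup>2" "D \<noteq> 0"
  shows "(\<lambda>n. z ^ n * ell2_trace (\<lambda>x. (H a ^^ n) x - (H 1 ^^ n) x)) sums
    (2 * ((of_real a)\<^sup>2 - 1) * (1 + q\<^sup>2) * q\<^sup>2 / (D * (1 - q\<^sup>2)))"
proof -
  let ?K = "max \<bar>a\<bar> 1 + 1"
  let ?d = "\<lambda>n k. coord ((H a ^^ n) (basis_vec k)) k - coord ((H 1 ^^ n) (basis_vec k)) k"
  have za: "norm z * (\<bar>b\<bar> + 1) < 1" if "\<bar>b\<bar> \<le> max \<bar>a\<bar> 1" for b
    using that z(2) mult_left_mono[of "\<bar>b\<bar> + 1" ?K "norm z"] by simp
  have bound: "norm (coord ((H b ^^ n) (basis_vec k)) k) \<le> ?K ^ n" if "\<bar>b\<bar> \<le> max \<bar>a\<bar> 1" for b n k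
  proof -
    have "norm (coord ((H b ^^ n) (basis_vec k)) k) \<le> (\<bar>b\<bar> + 1) ^ n"
      unfolding coord_H_power using norm_jacobi_power_le[of "coord (basis_vec k)" 1 n b k] by simp
    also have "\<dots> \<le> ?K ^ n"
      using that by (intro power_mono) auto
    finally show ?thesis .
  qed
  have "(\<lambda>n. \<Sum>k\<le>n. z ^ n * ?d n k) sums
      (2 * ((of_real a)\<^sup>2 - 1) * (1 + q\<^sup>2) * q\<^sup>2 / (D * (1 - q\<^sup>2)))"
  proof (rule sums_triangle_swap)
    show "0 \<le> norm z * ?K" "norm z * ?K < 1"
      using z(2) by auto
    show "norm (z ^ n * ?d n k) \<le> 2 * (norm z * ?K) ^ n" for n k
    proof -
      have "norm (?d n k) \<le> ?K ^ n + ?K ^ n"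
        by (rule order_trans[OF norm_triangle_ineq4]) (intro add_mono bound; simp)
      from mult_left_mono[OF this, of "norm z ^ n"] show ?thesis
        by (simp add: norm_mult norm_power power_mult_distrib)
    qed
    show "z ^ n * ?d n k = 0" if "n < k" for n k
      using coord_H_power_diff_eq_0[OF that, of a "basis_vec k"] by simp
    show "(\<lambda>n. z ^ n * ?d n k) sums (jacobi_green a q k k - jacobi_green 1 q k k)" for k
      unfolding right_diff_distrib
      using D by (intro sums_diff jacobi_green_sums q z(1) za) auto
  qed (rule jacobi_green_diag_diff_sums[OF q D])
  then show ?thesis
    by (simp add: trace_H_power_diff sum_distrib_left)
qed

section \<open>Closed form and its disc of holomorphy\<close>

text \<open>Since \<open>z\<^sup>2 = (1 - s) * (1 + s)\<close>, a factor \<open>1 - s\<close>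
  cancels. The reduced form vanishes at \<open>z = 0\<close>, in agreement with the limit used
  there.\<close>

lemma trace_gf_eq:
  fixes a z
  defines "s \<equiv> csqrt (1 - z\<^sup>2)"
  shows "trace_gf a z = 2 * ((of_real a)\<^sup>2 - 1) * (1 - s) / (s * (2 - (of_real a)\<^sup>2 + (of_real a)\<^sup>2 * s))"
proof (cases "z = 0")
  case True
  then show ?thesis
    using tendsto_Lim[OF _ trace_gf_formula_tendsto_0[of a]] by (simp add: trace_gf_def s_def)
next
  case False
  let ?\<alpha> = "complex_of_real a"
  have s2: "s\<^sup>2 = 1 - z\<^sup>2"
    by (simp add: s_def)
  then have s1: "1 - s \<noteq> 0"
    using False by auto
  have "z\<^sup>2 + (1 - ?\<alpha>\<^sup>2) * (1 - s)\<^sup>2 = (1 - s) * (2 - ?\<alpha>\<^sup>2 + ?\<alpha>\<^sup>2 * s)"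
    using s2 by algebra
  then have "trace_gf a z = 2 * (?\<alpha>\<^sup>2 - 1) / s * ((1 - s)\<^sup>2 / ((1 - s) * (2 - ?\<alpha>\<^sup>2 + ?\<alpha>\<^sup>2 * s)))"
    using False by (simp add: trace_gf_def trace_gf_formula_def s_def)
  then show ?thesis
    using s1 by (simp add: power2_eq_square)
qed

text \<open>The principal root has nonnegative real part; real part 0 would make the real part of
  its square nonpositive, forcing \<open>Re (z\<^sup>2) \<ge> 1\<close>.\<close>

lemma Re_csqrt_one_minus_pos:
  assumes "norm z < 1"
  shows "0 < Re (csqrt (1 - z\<^sup>2))"
proof (rule ccontr)
  let ?s = "csqrt (1 - z\<^sup>2)"
  assume "\<not> 0 < Re ?s"
  then have "Re ?s = 0"
    using csqrt_principal[of "1 - z\<^sup>2"] by linarith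
  then have "Re (?s\<^sup>2) \<le> 0"
    by (simp only: Re_power2) simp
  then have "1 \<le> Re (z\<^sup>2)"
    by simp
  also have "\<dots> \<le> (norm z)\<^sup>2"
    using complex_Re_le_cmod[of "z\<^sup>2"] by (simp add: norm_power)
  also have "\<dots> < 1"
    using assms by (simp add: abs_square_less_1)
  finally show False
    by simp
qed

text \<open>The value 1 is the distance to the branch points of \<open>s\<close>; the other value is
  the modulus of the zeros of \<open>2 - a\<^sup>2 + a\<^sup>2 * s\<close>, which lie in the unit
  disc only for \<open>a > sqrt 2\<close>.\<close>

definition trace_gf_radius :: "real \<Rightarrow> real" where
  "trace_gf_radius a = (if a \<le> sqrt 2 then 1 else 2 / a\<^sup>2 * sqrt (a\<^sup>2 - 1))"

lemma trace_gf_radius_bounds: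
  assumes "a > 0"
  shows "0 < trace_gf_radius a" "trace_gf_radius a \<le> 1"
proof -
  have "2 < a\<^sup>2" if "sqrt 2 < a"
    using that real_less_rsqrt real_sqrt_less_iff by (metis assms less_eq_real_def real_sqrt_unique)
  \<comment> \<open>The arithmetic-geometric mean inequality for \<open>a\<^sup>2 - 1\<close> and
    1.\<close>
  moreover have "2 * sqrt (a\<^sup>2 - 1) \<le> a\<^sup>2" if "2 < a\<^sup>2"
    using arith_geo_mean_sqrt[of "a\<^sup>2 - 1" 1] that by simp
  ultimately show "0 < trace_gf_radius a" "trace_gf_radius a \<le> 1"
    using assms by (auto simp: trace_gf_radius_def field_simps)
qed

text \<open>A zero forces \<open>s = (a\<^sup>2 - 2) / a\<^sup>2\<close>. As
  \<open>Re s > 0\<close>, this requires \<open>a\<^sup>2 > 2\<close>, and then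
  \<open>1 - s\<^sup>2\<close> gives \<open>norm z\<close> exactly equal to the radius.\<close>

lemma trace_gf_denominator_nonzero:
  assumes a: "a > 0" and z: "norm z < trace_gf_radius a"
  shows "2 - (of_real a)\<^sup>2 + (of_real a)\<^sup>2 * csqrt (1 - z\<^sup>2) \<noteq> 0"
proof
  let ?s = "csqrt (1 - z\<^sup>2)"
  assume eq: "2 - (of_real a)\<^sup>2 + (of_real a)\<^sup>2 * ?s = 0"
  have "norm z < 1"
    using z trace_gf_radius_bounds[OF a] by simp
  then have "0 < Re ?s"
    by (rule Re_csqrt_one_minus_pos)
  have s: "?s = of_real ((a\<^sup>2 - 2) / a\<^sup>2)"
    using eq a by (simp add: field_simps)
  with \<open>0 < Re ?s\<close> have "a\<^sup>2 > 2"
    using a by (simp add: zero_less_divide_iff del: csqrt.sel)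
  then have gt: "\<not> a \<le> sqrt 2"
    using a by (simp add: real_less_lsqrt real_sqrt_less_iff not_le)
  have "z\<^sup>2 = 1 - (of_real ((a\<^sup>2 - 2) / a\<^sup>2))\<^sup>2"
    unfolding s[symmetric] by simp
  also have "\<dots> = of_real (4 * (a\<^sup>2 - 1) / (a\<^sup>2)\<^sup>2)"
    using a by (simp add: field_simps power2_eq_square)
  finally have "norm (z\<^sup>2) = 4 * (a\<^sup>2 - 1) / (a\<^sup>2)\<^sup>2"
    using \<open>a\<^sup>2 > 2\<close> by (simp only: norm_of_real) simp
  also have "\<dots> = (trace_gf_radius a)\<^sup>2"
    using gt \<open>a\<^sup>2 > 2\<close> by (simp add: trace_gf_radius_def power_mult_distrib power_divide)
  finally have "norm z = trace_gf_radius a"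
    using trace_gf_radius_bounds(1)[OF a] by (simp add: norm_power)
  with z show False
    by simp
qed

lemma trace_gf_holomorphic:
  assumes "a > 0"
  shows "trace_gf a holomorphic_on ball 0 (trace_gf_radius a)"
proof -
  let ?f = "\<lambda>z. 2 * ((of_real a)\<^sup>2 - 1) * (1 - csqrt (1 - z\<^sup>2)) /
    (csqrt (1 - z\<^sup>2) * (2 - (of_real a)\<^sup>2 + (of_real a)\<^sup>2 * csqrt (1 - z\<^sup>2)))"
  have le: "trace_gf_radius a \<le> 1"
    using trace_gf_radius_bounds[OF assms] by simp
  then have "(\<lambda>z. csqrt (1 - z\<^sup>2)) holomorphic_on ball 0 (trace_gf_radius a)"
    by (intro holomorphic_on_subset[OF csqrt_branch(1)] subset_ball)
  moreover have "csqrt (1 - z\<^sup>2) \<noteq> 0" if "norm z < trace_gf_radius a" for z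
    using Re_csqrt_one_minus_pos[of z] that le by fastforce
  ultimately have "?f holomorphic_on ball 0 (trace_gf_radius a)"
    using trace_gf_denominator_nonzero[OF assms]
    by (intro holomorphic_on_divide holomorphic_on_mult holomorphic_on_diff holomorphic_on_add
        holomorphic_on_const) auto
  moreover have "trace_gf a = ?f"
    by (rule ext) (rule trace_gf_eq)
  ultimately show ?thesis
    by simp
qed

section \<open>From small arguments to the full disc\<close>

text \<open>Translates the sum from \<open>q\<close> back to \<open>z\<close>: with
  \<open>q = z / (1 + s)\<close> the quantities \<open>q\<^sup>2\<close>,
  \<open>1 + q\<^sup>2\<close>, \<open>1 - q\<^sup>2\<close> and \<open>D\<close> are all fractions
  over \<open>1 + s\<close>.\<close>

lemma trace_gf_sums_small:
  assumes a: "a > 0" and z: "norm z < trace_gf_radius a" "norm z * (max \<bar>a\<bar> 1 + 1) < 1"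
  shows "(\<lambda>n. z ^ n * ell2_trace (\<lambda>x. (H a ^^ n) x - (H 1 ^^ n) x)) sums trace_gf a z"
proof -
  let ?\<alpha> = "complex_of_real a"
  define s where "s = csqrt (1 - z\<^sup>2)"
  define q where "q = z / (1 + s)"
  define D where "D = 1 + (1 - ?\<alpha>\<^sup>2) * q\<^sup>2"
  have Re_s: "0 < Re s"
    unfolding s_def by (rule Re_csqrt_one_minus_pos) (use z trace_gf_radius_bounds[OF a] in simp)
  then have nz: "s \<noteq> 0" "1 + s \<noteq> 0"
    by (auto simp: complex_eq_iff)
  have s2: "z\<^sup>2 = (1 - s) * (1 + s)"
    using csqrt_branch(2)[of z] by (simp add: s_def algebra_simps power2_eq_square)
  then have q2: "q\<^sup>2 = (1 - s) / (1 + s)"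
    using nz by (simp add: q_def power_divide power2_eq_square)
  have den: "2 - ?\<alpha>\<^sup>2 + ?\<alpha>\<^sup>2 * s \<noteq> 0"
    unfolding s_def by (rule trace_gf_denominator_nonzero[OF a z(1)])
  have P: "1 + q\<^sup>2 = 2 / (1 + s)" and Q: "1 - q\<^sup>2 = 2 * s / (1 + s)"
    and D_eq: "D = (2 - ?\<alpha>\<^sup>2 + ?\<alpha>\<^sup>2 * s) / (1 + s)"
    unfolding D_def q2 using nz by (simp_all add: field_simps)
  \<comment> \<open>The two sides differ by \<open>4 * Re s\<close>; this places \<open>q\<close>
    inside the unit disc.\<close>
  have "(cmod (1 - s))\<^sup>2 < (cmod (1 + s))\<^sup>2"
    using Re_s unfolding cmod_power2 by (simp add: power2_eq_square algebra_simps)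
  then have "norm (q\<^sup>2) < 1"
    using nz by (simp add: q2 norm_divide power2_less_imp_less)
  then have q: "norm q < 1"
    by (simp add: norm_power abs_square_less_1)
  have zq: "z = 2 * q / (1 + q\<^sup>2)"
    unfolding P using nz by (simp add: q_def)
  \<comment> \<open>Here \<open>t\<close> stands for \<open>1 + s\<close> and \<open>w\<close> for
    the reduced denominator; all powers of \<open>t\<close> cancel.\<close>
  have "2 * b * (2 / t) * ((1 - s) / t) / (w / t * (2 * s / t)) = 2 * b * (1 - s) / (s * w)"
    if "t \<noteq> 0" "w \<noteq> 0" for b t w
    using that nz by (simp add: field_simps)
  from this[OF nz(2) den]
  have "2 * (?\<alpha>\<^sup>2 - 1) * (1 + q\<^sup>2) * q\<^sup>2 / (D * (1 - q\<^sup>2)) = trace_gf a z"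
    unfolding trace_gf_eq P Q D_eq s_def[symmetric] unfolding q2 .
  moreover have "D \<noteq> 0"
    using nz den by (simp add: D_eq)
  ultimately show ?thesis
    using trace_H_power_diff_sums_small[OF q zq z(2) D_def] by simp
qed

theorem corollary5p7:
  fixes a :: real
  assumes "a > 0"
  shows "(\<forall>z::complex.
            cmod z < (if a \<le> sqrt 2 then 1 else 2 / a\<^sup>2 * sqrt (a\<^sup>2 - 1)) \<longrightarrow>
            (\<lambda>n. z ^ Suc n * ell2_trace (\<lambda>x. (H a ^^ Suc n) x - (H 1 ^^ Suc n) x)) sums trace_gf a z)
       \<and> (\<forall>n. odd n \<longrightarrow> ell2_trace (\<lambda>x. (H a ^^ n) x - (H 1 ^^ n) x) = 0)"
proof (intro conjI allI impI)
  let ?c = "\<lambda>n. ell2_trace (\<lambda>x. (H a ^^ n) x - (H 1 ^^ n) x)"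
  \<comment> \<open>On the disc of radius \<open>\<delta>\<close> both conditions of the
    small-argument result hold.\<close>
  define \<delta> where "\<delta> = min (trace_gf_radius a) (1 / (max \<bar>a\<bar> 1 + 1))"
  have "\<delta> > 0"
    using trace_gf_radius_bounds(1)[OF assms] by (simp add: \<delta>_def add_pos_pos less_max_iff_disj)
  \<comment> \<open>An expansion near 0 suffices to identify the traces with the Taylor
    coefficients; holomorphy then carries convergence to the full disc.\<close>
  have "trace_gf a has_fps_expansion Abs_fps ?c"
  proof (rule has_fps_expansionI)
    have "(\<lambda>n. fps_nth (Abs_fps ?c) n * z ^ n) sums trace_gf a z" if "z \<in> ball 0 \<delta>" for z
      using trace_gf_sums_small[OF assms, of z] that
      by (simp add: \<delta>_def field_simps max_def split: if_splits)
    then show "\<forall>\<^sub>F z in nhds 0. (\<lambda>n. fps_nth (Abs_fps ?c) n * z ^ n) sums trace_gf a z"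
      using eventually_nhds_in_open[of "ball 0 \<delta>" 0] \<open>\<delta> > 0\<close> by (auto elim: eventually_mono)
  qed
  then have coeff: "?c n = (deriv ^^ n) (trace_gf a) 0 / fact n" for n
    using fps_nth_fps_expansion by fastforce
  fix z :: complex
  assume "cmod z < (if a \<le> sqrt 2 then 1 else 2 / a\<^sup>2 * sqrt (a\<^sup>2 - 1))"
  then have "z \<in> ball 0 (trace_gf_radius a)"
    by (simp add: trace_gf_radius_def)
  from holomorphic_power_series[OF trace_gf_holomorphic[OF assms] this]
  have "(\<lambda>n. z ^ n * ?c n) sums trace_gf a z"
    by (simp add: coeff mult.commute)
  \<comment> \<open>Both zeroth powers are the identity, so dropping the term \<open>n = 0\<close>
    leaves the sum unchanged.\<close>
  moreover have "?c 0 = 0"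
    using trace_H_power_diff[of 0 a] by simp
  ultimately show "(\<lambda>n. z ^ Suc n * ?c (Suc n)) sums trace_gf a z"
    by (subst sums_Suc_iff) simp
qed (rule trace_H_power_diff_odd)

end
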